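(* Let $\delta\ge 0$, let $\mathcal{O}$ be an accounting oracle, and consider the algorithm "DPVI for mixture models on vertically partitioned data" (DPVI-VPD) with $P$ parties, sampling probability $q$, $T$ iterations, clipping threshold $C$ and noise parameter $\sigma$, in the variant where a trusted third party adds the noise, i.e. $\boldsymbol{\zeta}\sim\mathcal{N}_{\mathbb{Z}}(0,C^2\sigma^2\mathbf{I})$ in each iteration. Then DPVI-VPD is $(\epsilon,\delta)$-VPDP with respect to each of the $P$ parties, where $$\epsilon=\mathcal{O}\bigl(\delta,Q,T,\mathcal{N}_{\mathbb{Z}}(0,\sigma^2)\bigr),$$ with $Q=q$ if the corresponding party cannot access the sub-sample indices, and $Q=1$ if they are known to that party.
   Context: Differential privacy and VPDP. A dataset is $\mathcal{D}=(x_1,\dots,x_N)$, each sample being split over $P$ parties as $x_n=(x_n^1,\dots,x_n^P)$, where party $p$ holds $x_n^p$ for all $n$. Two datasets are adjacent if they differ in one sample (one sample is replaced). They are VP-adjacent if they differ only in the $k$-th sample for some $k$, with values $x_k$ and $x_k'$, and for some party $p$ one has $x_k^p={x_k^p}'$ while $x_k^i\neq{x_k^i}'$ for all parties $i\ne p$. A randomised algorithm $\mathcal{A}$ is $(\epsilon,\delta)$-DP (respectively $(\epsilon,\delta)$-VPDP) if for all adjacent (respectively VP-adjacent) $\mathcal{D},\mathcal{D}'$ and measurable $S$, $\Pr(\mathcal{A}(\mathcal{D})\in S)\le e^{\epsilon}\Pr(\mathcal{A}(\mathcal{D}')\in S)+\delta$. Discrete Gaussian. $\mathcal{N}_{\mathbb{Z}}(0,s^2)$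 is the distribution on $\mathbb{Z}$ with mass at $z$ proportional to $\exp(-z^2/(2s^2))$; $\mathcal{N}_{\mathbb{Z}}(0,s^2\mathbf{I})$ on $\mathbb{Z}^d$ has i.i.d. such coordinates. Base mechanism. As an argument of the oracle, $\mathcal{N}_{\mathbb{Z}}(0,\sigma^2)$ denotes the discrete Gaussian mechanism with noise parameter $\sigma$ relative to the clipping threshold $C$: given a per-example function $f$ (possibly depending on the index) with values in $\{v\in\mathbb{Z}^d:\|v\|_2\le C\}$ and a set $B$ of indices, it outputs $\sum_{i\in B}f(i,x_i)+\boldsymbol{\zeta}$ with $\boldsymbol{\zeta}\sim\mathcal{N}_{\mathbb{Z}}(0,C^2\sigma^2\mathbf{I})$. With sub-sampling ratio $q$, $B\subseteq\{1,\dots,N\}$ is random, each index being included independently with probability $q$ (so $B=\{1,\dots,N\}$ for ratio $1$), and $B$ is not output. A $T$-fold composition runs the mechanism $T$ times with fresh independent noise and sub-samples, releases all outputs, and allows the per-example function of each step to depend on previous outputs and on data-independent randomness. Accounting oracle. An accounting oracle is a function $\mathcal{O}:(\delta,q,T,\mathcal{A})\mapsto\epsilon$ such that every $T$-fold composition of the base mechanism $\mathcal{A}$ with sub-sampling ratio $q$ is $(\epsilon,\delta)$-DP. Algorithm DPVI-VPD. The model is a $K$-component mixture with weights $\pi_k$ and component densities $\prod_{p=1}^P\mathcal{F}_p(x_n^p\mid\rho_k^p)$. All vectors entering the multiparty computation (MPC) are in fixed-point representation, i.e. (after scaling) integer vectors obtained by truncation towards zero, with $C$ measured in the same units. In each iteration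 $t=1,\dots,T$, with current parameters $(\pi,\rho)=(\pi^{(t)},\rho^{(t)})$: 1. A random subset $B\subseteq\{1,\dots,N\}$ is drawn, each index being included independently with probability $q$. 2. For each $n\in B$, under MPC, the per-example gradient vector $g_t(x_n)$ is formed; its entries are, for all $k,p$, $$\frac{\prod_{p'}\mathcal{F}_{p'}(x_n^{p'}\mid\rho_k^{p'})}{\sum_{l}\pi_l\prod_{p'}\mathcal{F}_{p'}(x_n^{p'}\mid\rho_l^{p'})}\quad\text{and}\quad \frac{\pi_k\,\frac{\partial \mathcal{F}_p(x_n^p\mid\rho_k^p)}{\partial\rho_k^p}\prod_{p'\ne p}\mathcal{F}_{p'}(x_n^{p'}\mid\rho_k^{p'})}{\sum_{l}\pi_l\prod_{p'}\mathcal{F}_{p'}(x_n^{p'}\mid\rho_l^{p'})}.$$ 3. It is clipped: $g_t^*(x_n)=g_t(x_n)/\max(1,\|g_t(x_n)\|_2/C)$ (in integer representation, so $\|g_t^*(x_n)\|_2\le C$). 4. The vector $\tilde g_t=\sum_{n\in B}g_t^*(x_n)+\boldsymbol{\zeta}$, with fresh noise $\boldsymbol{\zeta}$, is decrypted and released. 5. The data-independent log-prior and entropy gradients are added to $\tilde g_t$, and $(\pi,\rho)$ is updated using the result (and data-independent randomness). Views. The parties are honest-but-curious and the MPC is ideal: it reveals nothing except the released values. Besides its own features, a party observes the released values $\tilde g_1,\dots,\tilde g_T$ (hence the parameters) and, in the case where the sub-sample indices are known to it, the subsets $B$ of all iterations; it does not observe the noise. "VPDP with respect to a party" means that the randomised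 map from $\mathcal{D}$ to what the party observes besides its own features is VPDP. *)

theory Defs
  imports "HOL-Probability.Probability"
begin

section \<open>Differential privacy\<close>

text \<open>
  A dataset is a list of samples. For vertically partitioned data a sample is itself the list of
  the features held by the parties, so \<open>D ! n ! p\<close> is what party \<open>p\<close> holds of sample \<open>n\<close>
  (samples and parties are numbered from 0).
\<close>

definition adjacent :: "'x list \<Rightarrow> 'x list \<Rightarrow> bool" where
  "adjacent D D' \<longleftrightarrow> length D = length D' \<and>
     (\<exists>k<length D. D ! k \<noteq> D' ! k \<and> (\<forall>i<length D. i \<noteq> k \<longrightarrow> D ! i = D' ! i))"

definition vp_adjacent :: "nat \<Rightarrow> 'a list list \<Rightarrow> 'a list list \<Rightarrow> bool" where
  "vp_adjacent P D D' \<longleftrightarrow> length D = length D' \<and>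
     (\<exists>k<length D. (\<forall>i<length D. i \<noteq> k \<longrightarrow> D ! i = D' ! i) \<and>
        (\<exists>p<P. D ! k ! p = D' ! k ! p \<and> (\<forall>i<P. i \<noteq> p \<longrightarrow> D ! k ! i \<noteq> D' ! k ! i)))"

text \<open>
  The privacy parameter ranges over \<open>[0, \<infinity>]\<close>; \<open>\<epsilon> = \<infinity>\<close> stands for ``no guarantee''. It is needed
  because, e.g., Gaussian noise has no finite \<open>\<epsilon>\<close> at \<open>\<delta> = 0\<close>.
\<close>

definition private_wrt ::
    "('d \<Rightarrow> 'd \<Rightarrow> bool) \<Rightarrow> 'd set \<Rightarrow> ennreal \<Rightarrow> real \<Rightarrow> ('d \<Rightarrow> 'o measure) \<Rightarrow> bool" where
  "private_wrt adj Ds \<epsilon> \<delta> A \<longleftrightarrow>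
     (\<epsilon> \<noteq> \<infinity> \<longrightarrow>
       (\<forall>D\<in>Ds. \<forall>D'\<in>Ds. adj D D' \<longrightarrow>
         (\<forall>S\<in>sets (A D). measure (A D) S \<le> exp (enn2real \<epsilon>) * measure (A D') S + \<delta>)))"

abbreviation dp :: "'x list set \<Rightarrow> ennreal \<Rightarrow> real \<Rightarrow> ('x list \<Rightarrow> 'o measure) \<Rightarrow> bool" where
  "dp \<equiv> private_wrt adjacent"

abbreviation vpdp ::
    "nat \<Rightarrow> 'a list list set \<Rightarrow> ennreal \<Rightarrow> real \<Rightarrow> ('a list list \<Rightarrow> 'o measure) \<Rightarrow> bool" where
  "vpdp P \<equiv> private_wrt (vp_adjacent P)"


section \<open>Discrete Gaussian mechanism and Poisson sub-sampling\<close>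

definition discrete_gaussian :: "real \<Rightarrow> int pmf" where
  "discrete_gaussian s =
     embed_pmf (\<lambda>z. exp (- (of_int z)\<^sup>2 / (2 * s\<^sup>2)) / (\<Sum>\<^sub>\<infinity>w. exp (- (of_int w)\<^sup>2 / (2 * s\<^sup>2))))"

lemma summable_discrete_gaussian:
  fixes s :: real
  assumes s: "s > 0"
  shows "(\<lambda>w::int. exp (- (of_int w)\<^sup>2 / (2 * s\<^sup>2))) summable_on UNIV"
proof -
  define r where "r = exp (- 1 / (2 * s\<^sup>2))"
  have r: "0 < r" "r < 1" using s by (auto simp: r_def)
  have le: "exp (- (real n)\<^sup>2 / (2 * s\<^sup>2)) \<le> r ^ n" for n
  proof -
    have "real n \<le> (real n)\<^sup>2"
      by (cases n) (auto simp: power2_eq_square algebra_simps)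
    then have "- (real n)\<^sup>2 / (2 * s\<^sup>2) \<le> real n * (- 1 / (2 * s\<^sup>2))"
      using s by (simp add: field_simps)
    then show ?thesis by (simp add: r_def flip: exp_of_nat_mult)
  qed
  have geo: "(\<lambda>n. r ^ n) summable_on (UNIV :: nat set)"
    using r by (simp add: summable_on_UNIV_nonneg_real_iff summable_geometric)
  have nat: "(\<lambda>n::nat. exp (- (real n)\<^sup>2 / (2 * s\<^sup>2))) summable_on UNIV"
    by (rule summable_on_comparison_test[OF geo]) (use le in auto)
  have 1: "(\<lambda>w::int. exp (- (of_int w)\<^sup>2 / (2 * s\<^sup>2))) summable_on range int"
    by (subst summable_on_reindex) (use nat in \<open>auto simp: o_def\<close>)
  have 2: "(\<lambda>w::int. exp (- (of_int w)\<^sup>2 / (2 * s\<^sup>2))) summable_on range (\<lambda>n. - int n)"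
    by (subst summable_on_reindex) (use nat in \<open>auto simp: o_def inj_on_def\<close>)
  have "UNIV = range int \<union> range (\<lambda>n. - int n)"
    by (auto intro: int_cases2)
  then show ?thesis
    using summable_on_union[OF 1 2] by simp
qed

lemma pmf_discrete_gaussian:
  fixes s :: real
  assumes s: "s > 0"
  shows "pmf (discrete_gaussian s) z =
    exp (- (of_int z)\<^sup>2 / (2 * s\<^sup>2)) / (\<Sum>\<^sub>\<infinity>w. exp (- (of_int w)\<^sup>2 / (2 * s\<^sup>2)))"
proof -
  define g :: "int \<Rightarrow> real" where "g = (\<lambda>w. exp (- (of_int w)\<^sup>2 / (2 * s\<^sup>2)))"
  define Z where "Z = infsum g UNIV"
  have sm: "g summable_on UNIV"
    using summable_discrete_gaussian[OF s] by (simp add: g_def)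
  have "infsum g {0} \<le> Z" unfolding Z_def
    by (rule infsum_mono_neutral) (use sm in \<open>auto simp: g_def\<close>)
  then have Z: "Z > 0" by (simp add: g_def)
  have "Infinite_Set_Sum.abs_summable_on g UNIV"
    using sm by (simp add: g_def flip: abs_summable_equivalent)
  then have sm': "Infinite_Set_Sum.abs_summable_on (\<lambda>w. g w / Z) UNIV"
    using Infinite_Set_Sum.abs_summable_on_cmult_left[of "1 / Z" g UNIV] by simp
  have "infsetsum (\<lambda>w. g w / Z) UNIV = infsum (\<lambda>w. g w * (1 / Z)) UNIV"
    using sm' by (subst infsetsum_infsum) auto
  also have "\<dots> = 1"
    using Z by (subst infsum_cmult_left') (simp add: Z_def)
  finally have "(\<integral>\<^sup>+w. ennreal (g w / Z) \<partial>count_space UNIV) = 1"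
    using Z sm' by (subst nn_integral_conv_infsetsum) (auto simp: g_def)
  then have "pmf (embed_pmf (\<lambda>w. g w / Z)) z = g z / Z"
    using Z by (intro pmf_embed_pmf) (auto simp: g_def)
  then show ?thesis
    by (simp add: discrete_gaussian_def g_def Z_def)
qed

definition poisson_subsample :: "nat \<Rightarrow> real \<Rightarrow> nat set pmf" where
  "poisson_subsample N q =
     map_pmf (\<lambda>b. {i. i < N \<and> b i}) (Pi_pmf {..<N} False (\<lambda>_. bernoulli_pmf q))"

text \<open>Integer vectors of dimension \<open>d\<close> are lists of length \<open>d\<close>.\<close>

definition l2_norm :: "int list \<Rightarrow> real" where
  "l2_norm v = L2_set (\<lambda>j. real_of_int (v ! j)) {..<length v}"

text \<open>
  A base mechanism receives the dimension, a per-example function (which may depend on the index),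
  the dataset and the set of participating indices.
\<close>

type_synonym 'x base_mechanism =
  "nat \<Rightarrow> (nat \<Rightarrow> 'x \<Rightarrow> int list) \<Rightarrow> 'x list \<Rightarrow> nat set \<Rightarrow> int list pmf"

definition noisy_sum :: "nat \<Rightarrow> (nat \<Rightarrow> 'x \<Rightarrow> int list) \<Rightarrow> 'x list \<Rightarrow> nat set \<Rightarrow> int list \<Rightarrow> int list" where
  "noisy_sum d f D B \<zeta> = map (\<lambda>j. (\<Sum>i\<in>B. f i (D ! i) ! j) + \<zeta> ! j) [0..<d]"

definition discrete_gaussian_mechanism :: "real \<Rightarrow> real \<Rightarrow> 'x base_mechanism" where
  "discrete_gaussian_mechanism C \<sigma> d f D B =
     map_pmf (noisy_sum d f D B) (replicate_pmf d (discrete_gaussian (C * \<sigma>)))"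


section \<open>Compositions and accounting oracles\<close>

text \<open>
  The per-example function of each step is \<open>f ys\<close>, where \<open>ys\<close> is the list of the previous outputs
  in chronological order.
\<close>

primrec composition ::
    "'x base_mechanism \<Rightarrow> real \<Rightarrow> nat \<Rightarrow> (int list list \<Rightarrow> nat \<Rightarrow> 'x \<Rightarrow> int list) \<Rightarrow> 'x list
      \<Rightarrow> nat \<Rightarrow> int list list pmf" where
  "composition A q d f D 0 = return_pmf []"
| "composition A q d f D (Suc t) =
     do {
       ys \<leftarrow> composition A q d f D t;
       B \<leftarrow> poisson_subsample (length D) q;
       y \<leftarrow> A d (f ys) D B;
       return_pmf (ys @ [y])
     }"

text \<open>
  Data-independent randomness is a single \<open>\<omega>\<close> drawn from an arbitrary probability space \<open>R\<close>; it may
  be shared by all the steps, and is not part of the output of a composition.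
\<close>

definition randomised_composition ::
    "'x base_mechanism \<Rightarrow> real \<Rightarrow> nat \<Rightarrow> 'r measure
      \<Rightarrow> ('r \<Rightarrow> int list list \<Rightarrow> nat \<Rightarrow> 'x \<Rightarrow> int list) \<Rightarrow> nat \<Rightarrow> 'x list \<Rightarrow> int list list measure" where
  "randomised_composition A q d R f T D =
     R \<bind> (\<lambda>\<omega>. measure_pmf (composition A q d (f \<omega>) D T))"

text \<open>
  HOL cannot quantify over types inside a formula; the type \<open>'r\<close> of the data-independent randomness
  is passed explicitly. The clipping threshold \<open>C\<close> bounds the per-example functions. The kernel
  condition says that the composition is a well-defined randomised algorithm.
\<close>

definition accounting_oracle ::
    "'r itself \<Rightarrow> real \<Rightarrow> (real \<Rightarrow> real \<Rightarrow> nat \<Rightarrow> 'x base_mechanism \<Rightarrow> ennreal) \<Rightarrow> bool" where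
  "accounting_oracle _ C \<O> \<longleftrightarrow>
     (\<forall>\<delta> q T A N d (R :: 'r measure) f.
        0 \<le> \<delta> \<and> 0 \<le> q \<and> q \<le> 1 \<and> prob_space R \<and>
        (\<forall>\<omega>\<in>space R. \<forall>ys i x. length (f \<omega> ys i x) = d \<and> l2_norm (f \<omega> ys i x) \<le> C) \<and>
        (\<forall>D. length D = N \<longrightarrow>
           (\<lambda>\<omega>. measure_pmf (composition A q d (f \<omega>) D T)) \<in> R \<rightarrow>\<^sub>M subprob_algebra (count_space UNIV))
        \<longrightarrow> dp {D. length D = N} (\<O> \<delta> q T A) \<delta> (randomised_composition A q d R f T))"


section \<open>Mixture models on vertically partitioned data\<close>

text \<open>
  The parameters are \<open>(\<pi>, \<rho>)\<close>, where \<open>\<rho> k p\<close> is the parameter vector, with coordinates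
  \<open>j < rho_dim p\<close>, of party \<open>p\<close>'s factor of component \<open>k\<close>.
\<close>

type_synonym params = "(nat \<Rightarrow> real) \<times> (nat \<Rightarrow> nat \<Rightarrow> nat \<Rightarrow> real)"

record 'a mixture =
  parties :: nat
  components :: nat
  feature :: "nat \<Rightarrow> 'a measure"                         \<comment> \<open>feature space of a party, with base measure\<close>
  rho_dim :: "nat \<Rightarrow> nat"
  rho_space :: "nat \<Rightarrow> (nat \<Rightarrow> real) set"
  factor :: "nat \<Rightarrow> (nat \<Rightarrow> real) \<Rightarrow> 'a \<Rightarrow> real"          \<comment> \<open>\<open>factor p \<theta> y\<close> is \<open>\<F>\<^sub>p(y | \<theta>)\<close>\<close>

definition factor_partial :: "'a mixture \<Rightarrow> nat \<Rightarrow> nat \<Rightarrow> (nat \<Rightarrow> real) \<Rightarrow> 'a \<Rightarrow> real" where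
  "factor_partial m p j \<theta> y = deriv (\<lambda>u. factor m p (\<theta>(j := u)) y) (\<theta> j)"

definition mixture_model :: "'a mixture \<Rightarrow> bool" where
  "mixture_model m \<longleftrightarrow> parties m \<ge> 1 \<and> components m \<ge> 1 \<and>
     (\<forall>p<parties m.
        openin (product_topology (\<lambda>_. euclidean) {..<rho_dim m p}) (rho_space m p) \<and>
        (\<forall>\<theta>\<in>rho_space m p.
           factor m p \<theta> \<in> borel_measurable (feature m p) \<and>
           (\<forall>y\<in>space (feature m p). 0 \<le> factor m p \<theta> y) \<and>
           (\<integral>\<^sup>+y. ennreal (factor m p \<theta> y) \<partial>feature m p) = 1 \<and>
           (\<forall>y\<in>space (feature m p). \<forall>j<rho_dim m p.
              (\<lambda>u. factor m p (\<theta>(j := u)) y) differentiable (at (\<theta> j)))) \<and>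
        (\<forall>y\<in>space (feature m p).
           (\<lambda>\<theta>. factor m p \<theta> y) \<in> borel_measurable
              (restrict_space (Pi\<^sub>M {..<rho_dim m p} (\<lambda>_. borel)) (rho_space m p)) \<and>
           (\<forall>j<rho_dim m p. (\<lambda>\<theta>. factor_partial m p j \<theta> y) \<in> borel_measurable
              (restrict_space (Pi\<^sub>M {..<rho_dim m p} (\<lambda>_. borel)) (rho_space m p)))))"

definition datasets :: "'a mixture \<Rightarrow> nat \<Rightarrow> 'a list list set" where
  "datasets m N = {D. length D = N \<and>
     (\<forall>x\<in>set D. length x = parties m \<and> (\<forall>p<parties m. x ! p \<in> space (feature m p)))}"

definition valid_params :: "'a mixture \<Rightarrow> params \<Rightarrow> bool" where
  "valid_params m = (\<lambda>(\<pi>, \<rho>).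
     (\<forall>k<components m. 0 \<le> \<pi> k) \<and> (\<Sum>k<components m. \<pi> k) = 1 \<and>
     (\<forall>k<components m. \<forall>p<parties m. \<rho> k p \<in> rho_space m p))"

definition component_density :: "'a mixture \<Rightarrow> params \<Rightarrow> nat \<Rightarrow> 'a list \<Rightarrow> real" where
  "component_density m = (\<lambda>(\<pi>, \<rho>) k x. \<Prod>p<parties m. factor m p (\<rho> k p) (x ! p))"

definition mixture_density :: "'a mixture \<Rightarrow> params \<Rightarrow> 'a list \<Rightarrow> real" where
  "mixture_density m = (\<lambda>(\<pi>, \<rho>) x. \<Sum>l<components m. \<pi> l * component_density m (\<pi>, \<rho>) l x)"

text \<open>
  The entries are those of the gradient of the log of \<open>mixture_density\<close>: first the ones for the
  weights, then the ones for the coordinates of the \<open>\<rho> k p\<close>.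
\<close>

definition gradient :: "'a mixture \<Rightarrow> params \<Rightarrow> 'a list \<Rightarrow> real list" where
  "gradient m = (\<lambda>(\<pi>, \<rho>) x.
     [component_density m (\<pi>, \<rho>) k x / mixture_density m (\<pi>, \<rho>) x. k \<leftarrow> [0..<components m]] @
     [\<pi> k * factor_partial m p j (\<rho> k p) (x ! p) *
        (\<Prod>p'\<in>{..<parties m} - {p}. factor m p' (\<rho> k p') (x ! p')) / mixture_density m (\<pi>, \<rho>) x.
      k \<leftarrow> [0..<components m], p \<leftarrow> [0..<parties m], j \<leftarrow> [0..<rho_dim m p]])"

definition gradient_dim :: "'a mixture \<Rightarrow> nat" where
  "gradient_dim m = components m + components m * (\<Sum>p<parties m. rho_dim m p)"

definition truncate_to_int :: "real \<Rightarrow> int" where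
  "truncate_to_int y = (if 0 \<le> y then \<lfloor>y\<rfloor> else \<lceil>y\<rceil>)"

definition fixed_point :: "real \<Rightarrow> real list \<Rightarrow> int list" where
  "fixed_point scl v = map (\<lambda>y. truncate_to_int (scl * y)) v"

definition clip :: "real \<Rightarrow> int list \<Rightarrow> int list" where
  "clip C v = map (\<lambda>z. truncate_to_int (of_int z / max 1 (l2_norm v / C))) v"

definition clipped_gradient :: "'a mixture \<Rightarrow> real \<Rightarrow> real \<Rightarrow> params \<Rightarrow> 'a list \<Rightarrow> int list" where
  "clipped_gradient m scl C \<theta> x = clip C (fixed_point scl (gradient m \<theta> x))"


section \<open>The algorithm\<close>

text \<open>
  The data-independent part. \<open>seed\<close> is the distribution of all data-independent randomness
  \<open>\<omega>\<close>. The state consists of the current parameters \<open>(\<pi>, \<rho>)\<close> and an auxiliary component (e.g.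
  variational parameters, momentum); \<open>update t \<omega> st v\<close> is the state after iteration \<open>t\<close>
  if it was \<open>st\<close> before and \<open>v\<close> is the total gradient.
\<close>

record ('r, 's) optimiser =
  seed :: "'r measure"
  init :: "'r \<Rightarrow> params \<times> 's"
  prior_gradient :: "nat \<Rightarrow> 'r \<Rightarrow> params \<times> 's \<Rightarrow> real list"
  entropy_gradient :: "nat \<Rightarrow> 'r \<Rightarrow> params \<times> 's \<Rightarrow> real list"
  update :: "nat \<Rightarrow> 'r \<Rightarrow> params \<times> 's \<Rightarrow> real list \<Rightarrow> params \<times> 's"

text \<open>
  State after \<open>t\<close> iterations in which the vectors \<open>ys ! 0, \<dots>, ys ! (t - 1)\<close> were released
  (in integer representation, whence the division by \<open>scl\<close>).
\<close>

primrec state_after ::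
    "('r, 's) optimiser \<Rightarrow> nat \<Rightarrow> real \<Rightarrow> 'r \<Rightarrow> int list list \<Rightarrow> nat \<Rightarrow> params \<times> 's" where
  "state_after opt d scl \<omega> ys 0 = init opt \<omega>"
| "state_after opt d scl \<omega> ys (Suc t) =
     (let st = state_after opt d scl \<omega> ys t in
      update opt t \<omega> st
        (map (\<lambda>j. of_int (ys ! t ! j) / scl + prior_gradient opt t \<omega> st ! j
                   + entropy_gradient opt t \<omega> st ! j) [0..<d]))"

definition current_params ::
    "'a mixture \<Rightarrow> ('r, 's) optimiser \<Rightarrow> real \<Rightarrow> 'r \<Rightarrow> int list list \<Rightarrow> params" where
  "current_params m opt scl \<omega> ys = fst (state_after opt (gradient_dim m) scl \<omega> ys (length ys))"

text \<open>
  Besides the obvious typing conditions: for every history of released vectors, the current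
  parameters are random variables with values in the parameter space.
\<close>

definition valid_optimiser :: "'a mixture \<Rightarrow> real \<Rightarrow> ('r, 's) optimiser \<Rightarrow> bool" where
  "valid_optimiser m scl opt \<longleftrightarrow> prob_space (seed opt) \<and>
     (\<forall>t \<omega> st. length (prior_gradient opt t \<omega> st) = gradient_dim m \<and>
               length (entropy_gradient opt t \<omega> st) = gradient_dim m) \<and>
     (\<forall>ys. (\<forall>y\<in>set ys. length y = gradient_dim m) \<longrightarrow>
        (\<forall>\<omega>\<in>space (seed opt). valid_params m (current_params m opt scl \<omega> ys)) \<and>
        (\<forall>k<components m.
           (\<lambda>\<omega>. fst (current_params m opt scl \<omega> ys) k) \<in> borel_measurable (seed opt)) \<and>
        (\<forall>k<components m. \<forall>p<parties m.
           (\<lambda>\<omega>. snd (current_params m opt scl \<omega> ys) k p)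
             \<in> seed opt \<rightarrow>\<^sub>M Pi\<^sub>M {..<rho_dim m p} (\<lambda>_. borel)))"

text \<open>
  The execution for fixed data-independent randomness \<open>\<omega>\<close>: the list, over the iterations, of the
  released vector and the sub-sample. The noise is added by a trusted third party.
\<close>

primrec dpvi_vpd ::
    "'a mixture \<Rightarrow> ('r, 's) optimiser \<Rightarrow> real \<Rightarrow> real \<Rightarrow> real \<Rightarrow> real \<Rightarrow> 'r \<Rightarrow> 'a list list \<Rightarrow> nat
      \<Rightarrow> (int list \<times> nat set) list pmf" where
  "dpvi_vpd m opt scl q C \<sigma> \<omega> D 0 = return_pmf []"
| "dpvi_vpd m opt scl q C \<sigma> \<omega> D (Suc t) =
     do {
       trace \<leftarrow> dpvi_vpd m opt scl q C \<sigma> \<omega> D t;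
       let \<theta> = current_params m opt scl \<omega> (map fst trace);
       B \<leftarrow> poisson_subsample (length D) q;
       \<zeta> \<leftarrow> replicate_pmf (gradient_dim m) (discrete_gaussian (C * \<sigma>));
       return_pmf
         (trace @ [(noisy_sum (gradient_dim m) (\<lambda>_. clipped_gradient m scl C \<theta>) D B \<zeta>, B)])
     }"

text \<open>
  What a party observes besides its own features. The parties know the data-independent randomness
  \<open>\<omega>\<close>, which together with the released vectors determines the parameters of all iterations.
\<close>

definition party_view ::
    "'a mixture \<Rightarrow> ('r, 's) optimiser \<Rightarrow> real \<Rightarrow> real \<Rightarrow> real \<Rightarrow> real \<Rightarrow> nat \<Rightarrow> bool \<Rightarrow> 'a list list
      \<Rightarrow> ('r \<times> int list list \<times> nat set list option) measure" where
  "party_view m opt scl q C \<sigma> T knows_indices D =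
     seed opt \<bind> (\<lambda>\<omega>.
       distr (measure_pmf (dpvi_vpd m opt scl q C \<sigma> \<omega> D T)) (seed opt \<Otimes>\<^sub>M count_space UNIV)
         (\<lambda>trace. (\<omega>, map fst trace, if knows_indices then Some (map snd trace) else None)))"

end

theory Submission
  imports Defs
begin

text \<open>
  For every value \<open>\<omega>\<close> of the data-independent randomness, the released vectors are the output of a
  composition of the base mechanism with ratio \<open>q\<close>, since the current parameters are a function of
  the previous outputs. If the sub-samples are observed as well, condition on them: as they do not
  depend on the data, the released vectors are then the output of a composition with ratio 1 whose
  per-example functions vanish outside the sub-sample. In both cases the oracle's bound holds
  conditionally, and integrating it over \<open>\<omega>\<close> and the sub-samples preserves it, as these have the same
  law for both datasets. VP-adjacent datasets are adjacent or, in the case of a single party, equal.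
\<close>

section \<open>Closure properties of differential privacy\<close>

text \<open>A pair of equal datasets costs nothing, as \<open>enn2real \<epsilon>\<close> is
  nonnegative, so its exponential is at least 1, and \<delta> is nonnegative. This absorbs
  VP-adjacent pairs that are not adjacent.\<close>

lemma private_wrt_mono:
  assumes "private_wrt adj Ds \<epsilon> \<delta> A" and "Ds' \<subseteq> Ds" and "\<delta> \<ge> 0"
    and "\<And>D D'. D \<in> Ds' \<Longrightarrow> D' \<in> Ds' \<Longrightarrow> adj' D D' \<Longrightarrow> adj D D' \<or> D = D'"
  shows "private_wrt adj' Ds' \<epsilon> \<delta> A"
  unfolding private_wrt_def
proof (intro impI ballI)
  fix D D' S assume *: "\<epsilon> \<noteq> \<infinity>" "D \<in> Ds'" "D' \<in> Ds'" "adj' D D'" "S \<in> sets (A D)"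
  show "measure (A D) S \<le> exp (enn2real \<epsilon>) * measure (A D') S + \<delta>"
  proof (cases "D = D'")
    case True
    have "1 * measure (A D) S \<le> exp (enn2real \<epsilon>) * measure (A D) S"
      by (intro mult_right_mono) auto
    with True \<open>\<delta> \<ge> 0\<close> show ?thesis by simp
  next
    case False
    with assms(4) * have "adj D D'" by blast
    with assms(1,2) * show ?thesis unfolding private_wrt_def by blast
  qed
qed

lemma private_wrt_cong:
  assumes "private_wrt adj Ds \<epsilon> \<delta> A" and "\<And>D. D \<in> Ds \<Longrightarrow> A' D = A D"
  shows "private_wrt adj Ds \<epsilon> \<delta> A'"
  using assms by (simp add: private_wrt_def)

text \<open>Post-processing by a fixed map: an event pulls back along \<open>g\<close> to a set of
  outcomes, and every such set is an event of a pmf. Hence only the range of \<open>g\<close>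
  matters.\<close>

lemma private_wrt_distr_pmf:
  assumes A: "private_wrt adj Ds \<epsilon> \<delta> (\<lambda>D. measure_pmf (A D))" and g: "g \<in> UNIV \<rightarrow> space M"
  shows "private_wrt adj Ds \<epsilon> \<delta> (\<lambda>D. distr (measure_pmf (A D)) M g)"
  unfolding private_wrt_def
proof (intro impI ballI)
  fix D D' S
  assume *: "\<epsilon> \<noteq> \<infinity>" "D \<in> Ds" "D' \<in> Ds" "adj D D'" "S \<in> sets (distr (measure_pmf (A D)) M g)"
  from A *(1-4) have "measure_pmf.prob (A D) (g -` S)
      \<le> exp (enn2real \<epsilon>) * measure_pmf.prob (A D') (g -` S) + \<delta>"
    by (simp add: private_wrt_def)
  then show "measure (distr (measure_pmf (A D)) M g) S
      \<le> exp (enn2real \<epsilon>) * measure (distr (measure_pmf (A D')) M g) S + \<delta>"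
    using g * by (simp add: measure_distr)
qed

lemma private_wrt_map_pmf:
  assumes "private_wrt adj Ds \<epsilon> \<delta> (\<lambda>D. measure_pmf (A D))"
  shows "private_wrt adj Ds \<epsilon> \<delta> (\<lambda>D. measure_pmf (map_pmf g (A D)))"
  unfolding map_pmf_rep_eq using assms by (intro private_wrt_distr_pmf) auto

text \<open>The law \<open>R\<close> does not depend on the dataset, so the inequality for each
  \<omega> can be integrated. Since \<open>R\<close> has total mass 1, the additive term remains
  \<delta>.\<close>

lemma private_wrt_bind:
  assumes R: "prob_space R"
    and \<kappa>: "\<And>D. D \<in> Ds \<Longrightarrow> \<kappa> D \<in> R \<rightarrow>\<^sub>M subprob_algebra M"
    and priv: "\<And>\<omega>. \<omega> \<in> space R \<Longrightarrow> private_wrt adj Ds \<epsilon> \<delta> (\<lambda>D. \<kappa> D \<omega>)"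
  shows "private_wrt adj Ds \<epsilon> \<delta> (\<lambda>D. R \<bind> \<kappa> D)"
  unfolding private_wrt_def
proof (intro impI ballI)
  fix D D' S
  assume \<epsilon>: "\<epsilon> \<noteq> \<infinity>" and D: "D \<in> Ds" "D' \<in> Ds" "adj D D'" and "S \<in> sets (R \<bind> \<kappa> D)"
  interpret prob_space R by (rule R)
  have S: "S \<in> sets M"
    using \<open>S \<in> sets (R \<bind> \<kappa> D)\<close> sets_bind_measurable[OF \<kappa>[OF D(1)]] not_empty by simp
  have int: "integrable R (\<lambda>\<omega>. measure (\<kappa> E \<omega>) S)" if "E \<in> Ds" for E
  proof (rule integrable_const_bound[where B=1])
    have "measure (\<kappa> E \<omega>) S \<le> 1" if "\<omega> \<in> space R" for \<omega>
      by (rule subprob_space.subprob_measure_le_1[OF subprob_space_kernel[OF \<kappa>[OF \<open>E \<in> Ds\<close>] that]])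
    then show "AE \<omega> in R. norm (measure (\<kappa> E \<omega>) S) \<le> 1" by simp
    show "(\<lambda>\<omega>. measure (\<kappa> E \<omega>) S) \<in> borel_measurable R"
      using measurable_compose[OF \<kappa>[OF that] measurable_measure_subprob_algebra[OF S]] .
  qed
  have "measure (R \<bind> \<kappa> D) S = (\<integral>\<omega>. measure (\<kappa> D \<omega>) S \<partial>R)"
    by (rule measure_bind[OF \<kappa>[OF D(1)] S])
  also have "\<dots> \<le> (\<integral>\<omega>. exp (enn2real \<epsilon>) * measure (\<kappa> D' \<omega>) S + \<delta> \<partial>R)"
  proof (rule integral_mono)
    fix \<omega> assume "\<omega> \<in> space R"
    then show "measure (\<kappa> D \<omega>) S \<le> exp (enn2real \<epsilon>) * measure (\<kappa> D' \<omega>) S + \<delta>"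
      using priv D \<epsilon> S sets_kernel[OF \<kappa>[OF D(1)]] unfolding private_wrt_def by blast
  qed (use int D in simp_all)
  also have "\<dots> = exp (enn2real \<epsilon>) * measure (R \<bind> \<kappa> D') S + \<delta>"
    using int[OF D(2)] by (simp add: measure_bind[OF \<kappa>[OF D(2)] S] prob_space)
  finally show "measure (R \<bind> \<kappa> D) S \<le> exp (enn2real \<epsilon>) * measure (R \<bind> \<kappa> D') S + \<delta>" .
qed

text \<open>The samples at the distinguished index can coincide only if there is no second party,
  whose features would have to differ; then the datasets are equal.\<close>

lemma vp_adjacent_imp_adjacent:
  assumes "D \<in> datasets m N" and "D' \<in> datasets m N" and vp: "vp_adjacent (parties m) D D'"
  shows "adjacent D D' \<or> D = D'"
proof -
  from vp obtain k where k: "length D = length D'" "k < length D"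
    "\<And>i. i < length D \<Longrightarrow> i \<noteq> k \<Longrightarrow> D ! i = D' ! i"
    unfolding vp_adjacent_def by blast
  show ?thesis
  proof (cases "D ! k = D' ! k")
    case True
    with k show ?thesis by (metis nth_equalityI)
  next
    case False
    with k show ?thesis by (auto simp: adjacent_def)
  qed
qed

section \<open>Accounting for fixed randomness\<close>

text \<open>
  An accounting oracle bounds the outputs of a composition without its data-independent
  randomness \<open>\<omega>\<close>. Applying it to a family of functions that ignores \<open>\<omega>\<close> gives a bound that can
  be integrated against any events depending on \<open>\<omega>\<close>.
\<close>

lemma accounting_oracleD:
  assumes O: "accounting_oracle TYPE('r) C \<O>" and "\<delta> \<ge> 0" "0 \<le> q" "q \<le> 1"
    and f: "\<And>ys i x. length (f ys i x) = d \<and> l2_norm (f ys i x) \<le> C"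
  shows "dp {D. length D = N} (\<O> \<delta> q T A) \<delta> (\<lambda>D. measure_pmf (composition A q d f D T))"
proof -
  \<comment> \<open>With a function that ignores the randomness, a point mass will do: the kernel is
    constant, and binding it to \<open>R\<close> returns the composition itself.\<close>
  define R :: "'r measure" where "R = return (count_space UNIV) undefined"
  have R: "prob_space R" unfolding R_def by (rule prob_space_return) simp
  have "dp {D. length D = N} (\<O> \<delta> q T A) \<delta> (randomised_composition A q d R (\<lambda>_. f) T)"
    using O[unfolded accounting_oracle_def, rule_format, of \<delta> q R "\<lambda>_. f" d N A T] assms R
    by (simp add: space_subprob_algebra measure_pmf.subprob_space_axioms)
  moreover have "randomised_composition A q d R (\<lambda>_. f) T D = measure_pmf (composition A q d f D T)" for D
    unfolding randomised_composition_def
    by (rule bind_const'[OF R]) (rule measure_pmf.subprob_space_axioms)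
  ultimately show ?thesis by (simp add: private_wrt_def)
qed

section \<open>Sub-samples encoded in per-example functions\<close>

lemma length_composition:
  "ys \<in> set_pmf (composition A q d f D t) \<Longrightarrow> length ys = t"
  by (induction t arbitrary: ys) auto

text \<open>Each step evaluates its function only at the list of earlier outputs, which is shorter
  than \<open>t\<close>.\<close>

lemma composition_cong:
  "(\<And>ys. length ys < t \<Longrightarrow> f ys = g ys) \<Longrightarrow> composition A q d f D t = composition A q d g D t"
proof (induction t)
  case (Suc t)
  then have "composition A q d f D t = composition A q d g D t" by simp
  with Suc.prems show ?case
    by (auto intro!: bind_pmf_cong dest: length_composition)
qed simp

lemma set_poisson_subsample: "set_pmf (poisson_subsample N q) \<subseteq> Pow {..<N}"
  by (auto simp: poisson_subsample_def)

lemma bernoulli_pmf_1: "bernoulli_pmf 1 = return_pmf True"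
  by (rule pmf_eqI) (simp add: indicator_def split: bool.split)

lemma poisson_subsample_1: "poisson_subsample N 1 = return_pmf {..<N}"
  by (auto simp: poisson_subsample_def bernoulli_pmf_1)

text \<open>Steps are counted from 0, so a history of length s belongs to step s and selects
  \<open>Bs ! s\<close>. The zero vector contributes nothing to the sum and respects any nonnegative
  clipping bound.\<close>

definition restrict_steps ::
    "nat \<Rightarrow> nat set list \<Rightarrow> (int list list \<Rightarrow> nat \<Rightarrow> 'x \<Rightarrow> int list) \<Rightarrow> int list list \<Rightarrow> nat \<Rightarrow> 'x \<Rightarrow> int list" where
  "restrict_steps d Bs f ys i x = (if i \<in> Bs ! length ys then f ys i x else replicate d 0)"

lemma noisy_sum_restrict:
  assumes "B \<subseteq> {..<N}"
  shows "noisy_sum d (\<lambda>i x. if i \<in> B then f i x else replicate d 0) D {..<N} \<zeta> = noisy_sum d f D B \<zeta>"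
proof -
  have "(\<Sum>i<N. (if i \<in> B then f i (D ! i) else replicate d 0) ! j) = (\<Sum>i\<in>B. f i (D ! i) ! j)"
    if "j < d" for j
    using assms that by (intro sum.mono_neutral_cong_right) auto
  then show ?thesis by (auto simp: noisy_sum_def)
qed

section \<open>Clipped gradients\<close>

lemma abs_truncate_to_int_le: "\<bar>real_of_int (truncate_to_int y)\<bar> \<le> \<bar>y\<bar>"
  unfolding truncate_to_int_def by (cases "0 \<le> y"; simp; linarith)

text \<open>Division by \<open>M\<close> brings the norm down to at most \<open>C\<close>.
  Truncation towards zero then shrinks every entry in absolute value, so rounding cannot undo
  this.\<close>

lemma l2_norm_clip:
  assumes "C > 0"
  shows "l2_norm (clip C v) \<le> C"
proof -
  define M where "M = max 1 (l2_norm v / C)"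
  have M: "M \<ge> 1" "l2_norm v \<le> C * M"
    using assms by (auto simp: M_def max_def field_simps)
  have "l2_norm (clip C v) = L2_set (\<lambda>j. \<bar>real_of_int (truncate_to_int (of_int (v ! j) / M))\<bar>) {..<length v}"
    unfolding l2_norm_def clip_def M_def[unfolded l2_norm_def] by (simp add: L2_set_def)
  also have "\<dots> \<le> L2_set (\<lambda>j. \<bar>of_int (v ! j) * (1 / M)\<bar>) {..<length v}"
    by (intro L2_set_mono) (use abs_truncate_to_int_le[of "of_int (v ! _) / M"] in auto)
  also have "\<dots> = l2_norm v * (1 / M)"
    using M by (subst l2_norm_def, subst L2_set_left_distrib) (simp_all add: L2_set_def power_divide)
  also have "\<dots> \<le> C"
    using M by (simp add: field_simps)
  finally show ?thesis .
qed

lemma length_clipped_gradient: "length (clipped_gradient m scl C \<theta> x) = gradient_dim m"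
  by (simp add: clipped_gradient_def clip_def fixed_point_def gradient_def gradient_dim_def
      case_prod_beta length_concat o_def interv_sum_list_conv_sum_set_nat atLeast0LessThan)

section \<open>Measurability of clipped gradients in the data-independent randomness\<close>

lemma measurable_map_apply:
  fixes gs :: "('w \<Rightarrow> 'b::countable) list"
  assumes "\<And>g. g \<in> set gs \<Longrightarrow> g \<in> M \<rightarrow>\<^sub>M count_space UNIV"
  shows "(\<lambda>\<omega>. map (\<lambda>g. g \<omega>) gs) \<in> M \<rightarrow>\<^sub>M count_space UNIV"
  using assms
proof (induction gs)
  case (Cons g gs)
  then have IH: "(\<lambda>\<omega>. map (\<lambda>g. g \<omega>) gs) \<in> M \<rightarrow>\<^sub>M count_space UNIV" by simp
  \<comment> \<open>The head takes countably many values, so it is enough to treat each fixed head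
    \<open>a\<close>.\<close>
  have "(\<lambda>\<omega>. a # map (\<lambda>g. g \<omega>) gs) \<in> M \<rightarrow>\<^sub>M count_space UNIV" for a
    by (rule measurable_compose[OF IH]) simp
  from measurable_compose_countable[OF this, of g] Cons.prems show ?case by simp
qed simp

lemma measurable_truncate_to_int [measurable]: "truncate_to_int \<in> borel \<rightarrow>\<^sub>M count_space UNIV"
  unfolding truncate_to_int_def[abs_def] by measurable

lemma measurable_clipped_gradient:
  assumes m: "mixture_model m"
    and x: "\<And>p. p < parties m \<Longrightarrow> x ! p \<in> space (feature m p)"
    and \<theta>: "\<And>\<omega>. \<omega> \<in> space M \<Longrightarrow> valid_params m (\<theta> \<omega>)"
    and \<pi>[measurable]: "\<And>k. k < components m \<Longrightarrow> (\<lambda>\<omega>. fst (\<theta> \<omega>) k) \<in> borel_measurable M"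
    and \<rho>: "\<And>k p. k < components m \<Longrightarrow> p < parties m \<Longrightarrow>
      (\<lambda>\<omega>. snd (\<theta> \<omega>) k p) \<in> M \<rightarrow>\<^sub>M Pi\<^sub>M {..<rho_dim m p} (\<lambda>_. borel)"
  shows "(\<lambda>\<omega>. clipped_gradient m scl C (\<theta> \<omega>) x) \<in> M \<rightarrow>\<^sub>M count_space UNIV"
proof -
  \<comment> \<open>The model provides measurability of the factors in their parameter only on
    \<open>rho_space m p\<close>, so the parameters are regarded as random elements of that
    subspace.\<close>
  have \<rho>': "(\<lambda>\<omega>. snd (\<theta> \<omega>) k p)
      \<in> M \<rightarrow>\<^sub>M restrict_space (Pi\<^sub>M {..<rho_dim m p} (\<lambda>_. borel)) (rho_space m p)"
    if "k < components m" "p < parties m" for k p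
    using \<rho>[OF that] \<theta> that
    by (intro measurable_restrict_space2) (auto simp: valid_params_def case_prod_beta)
  have F[measurable]: "(\<lambda>\<omega>. factor m p (snd (\<theta> \<omega>) k p) (x ! p)) \<in> borel_measurable M"
    if "k < components m" "p < parties m" for k p
    using m x[OF that(2)] that(2)
    by (intro measurable_compose[OF \<rho>'[OF that], where g = "\<lambda>\<theta>. factor m p \<theta> (x ! p)"])
      (auto simp: mixture_model_def)
  have F'[measurable]: "(\<lambda>\<omega>. factor_partial m p j (snd (\<theta> \<omega>) k p) (x ! p)) \<in> borel_measurable M"
    if "k < components m" "p < parties m" "j < rho_dim m p" for k p j
    using m x[OF that(2)] that(2,3)
    by (intro measurable_compose[OF \<rho>'[OF that(1,2)], where g = "\<lambda>\<theta>. factor_partial m p j \<theta> (x ! p)"])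
      (auto simp: mixture_model_def)
  have cd[measurable]: "(\<lambda>\<omega>. component_density m (\<theta> \<omega>) k x) \<in> borel_measurable M"
    if "k < components m" for k
    using that unfolding component_density_def case_prod_beta by measurable
  have md[measurable]: "(\<lambda>\<omega>. mixture_density m (\<theta> \<omega>) x) \<in> borel_measurable M"
    unfolding mixture_density_def case_prod_beta prod.collapse by measurable
  \<comment> \<open>The integer gradient as a list of random integers. Clipping it afterwards is a
    map between discrete spaces, hence measurable.\<close>
  define gs where "gs =
     [\<lambda>\<omega>. truncate_to_int (scl * (component_density m (\<theta> \<omega>) k x / mixture_density m (\<theta> \<omega>) x)).
       k \<leftarrow> [0..<components m]] @
     [\<lambda>\<omega>. truncate_to_int (scl * (fst (\<theta> \<omega>) k * factor_partial m p j (snd (\<theta> \<omega>) k p) (x ! p) *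
        (\<Prod>p'\<in>{..<parties m} - {p}. factor m p' (snd (\<theta> \<omega>) k p') (x ! p')) / mixture_density m (\<theta> \<omega>) x)).
      k \<leftarrow> [0..<components m], p \<leftarrow> [0..<parties m], j \<leftarrow> [0..<rho_dim m p]]"
  have "fixed_point scl (gradient m (\<theta> \<omega>) x) = map (\<lambda>g. g \<omega>) gs" for \<omega>
    by (simp add: fixed_point_def gradient_def case_prod_beta gs_def map_concat o_def)
  moreover have "(\<lambda>\<omega>. map (\<lambda>g. g \<omega>) gs) \<in> M \<rightarrow>\<^sub>M count_space UNIV"
  proof (rule measurable_map_apply)
    fix g assume "g \<in> set gs"
    then show "g \<in> M \<rightarrow>\<^sub>M count_space UNIV"
      unfolding gs_def by (auto; measurable)
  qed
  ultimately show ?thesis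
    unfolding clipped_gradient_def by simp
qed

section \<open>Executions as compositions\<close>

definition gradient_step ::
    "'a mixture \<Rightarrow> ('r, 's) optimiser \<Rightarrow> real \<Rightarrow> real \<Rightarrow> 'r \<Rightarrow> int list list \<Rightarrow> nat \<Rightarrow> 'a list \<Rightarrow> int list" where
  "gradient_step m opt scl C \<omega> ys i = clipped_gradient m scl C (current_params m opt scl \<omega> ys)"

text \<open>The parameters depend on \<omega> and the released vectors, never on the sub-samples.
  Forgetting the latter therefore leaves a recursion on the released vectors alone.\<close>

lemma map_fst_dpvi_vpd:
  "map_pmf (map fst) (dpvi_vpd m opt scl q C \<sigma> \<omega> D t) =
     composition (discrete_gaussian_mechanism C \<sigma>) q (gradient_dim m) (gradient_step m opt scl C \<omega>) D t"
proof (induction t)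
  case (Suc t)
  show ?case
    unfolding composition.simps Suc[symmetric]
    by (simp add: map_bind_pmf bind_map_pmf discrete_gaussian_mechanism_def
        gradient_step_def[abs_def] Let_def map_pmf_def bind_assoc_pmf bind_return_pmf)
qed simp

text \<open>The sub-samples are independent of the released vectors and can all be drawn in advance.
  Given them, each iteration sums over all indices, with the vectors outside its sub-sample replaced
  by zero.\<close>

lemma dpvi_vpd_eq_mixture:
  "dpvi_vpd m opt scl q C \<sigma> \<omega> D t =
     bind_pmf (replicate_pmf t (poisson_subsample (length D) q)) (\<lambda>Bs.
       map_pmf (\<lambda>ys. zip ys Bs)
         (composition (discrete_gaussian_mechanism C \<sigma>) 1 (gradient_dim m)
            (restrict_steps (gradient_dim m) Bs (gradient_step m opt scl C \<omega>)) D t))"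
    (is "_ = bind_pmf (?R t) (\<lambda>Bs. map_pmf (?zip Bs) (?comp Bs t))")
proof (induction t)
  case (Suc t)
  let ?d = "gradient_dim m" and ?f = "gradient_step m opt scl C \<omega>"
  let ?P = "poisson_subsample (length D) q"
  let ?G = "replicate_pmf ?d (discrete_gaussian (C * \<sigma>))"
  \<comment> \<open>Appending \<open>B\<close> leaves the first \<open>t\<close> steps unchanged, as
    their histories are shorter than \<open>t\<close>; the next step has history length
    \<open>t\<close> and reads exactly \<open>B\<close>.\<close>
  have step: "map_pmf (?zip (Bs @ [B])) (?comp (Bs @ [B]) (Suc t)) =
      bind_pmf (?comp Bs t) (\<lambda>ys. bind_pmf ?G (\<lambda>\<zeta>. return_pmf (zip ys Bs @ [(noisy_sum ?d (?f ys) D B \<zeta>, B)])))"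
    if Bs: "length Bs = t" and B: "B \<in> set_pmf ?P" for Bs B
  proof -
    have "?comp (Bs @ [B]) t = ?comp Bs t"
      using Bs by (intro composition_cong) (auto simp: restrict_steps_def[abs_def] nth_append)
    moreover have "noisy_sum ?d (restrict_steps ?d (Bs @ [B]) ?f ys) D {..<length D} \<zeta> = noisy_sum ?d (?f ys) D B \<zeta>"
      if "ys \<in> set_pmf (?comp Bs t)" for ys \<zeta>
      using noisy_sum_restrict[of B "length D" ?d "?f ys" D \<zeta>] B Bs set_poisson_subsample[of "length D" q] length_composition[OF that]
      by (simp add: restrict_steps_def[abs_def] nth_append subset_iff)
    moreover have "zip (ys @ [y]) (Bs @ [B]) = zip ys Bs @ [(y, B)]" if "ys \<in> set_pmf (?comp Bs t)" for ys y
      using Bs length_composition[OF that] by simp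
    ultimately show ?thesis
      using Bs
      by (auto simp: poisson_subsample_1 bind_return_pmf discrete_gaussian_mechanism_def map_bind_pmf
          bind_map_pmf map_pmf_def bind_assoc_pmf dest: length_composition intro!: bind_pmf_cong)
  qed
  have "dpvi_vpd m opt scl q C \<sigma> \<omega> D (Suc t) =
      bind_pmf (?R t) (\<lambda>Bs. bind_pmf (?comp Bs t) (\<lambda>ys. bind_pmf ?P (\<lambda>B. bind_pmf ?G (\<lambda>\<zeta>.
        return_pmf (zip ys Bs @ [(noisy_sum ?d (?f ys) D B \<zeta>, B)])))))"
    by (auto simp: Suc bind_map_pmf bind_assoc_pmf map_pmf_def bind_return_pmf gradient_step_def[abs_def]
        Let_def set_replicate_pmf dest!: length_composition intro!: bind_pmf_cong)
  \<comment> \<open>The new sub-sample and the earlier outputs are independent, so the order of the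
    two draws can be exchanged.\<close>
  also have "\<dots> = bind_pmf (?R t) (\<lambda>Bs. bind_pmf ?P (\<lambda>B. bind_pmf (?comp Bs t) (\<lambda>ys. bind_pmf ?G (\<lambda>\<zeta>.
        return_pmf (zip ys Bs @ [(noisy_sum ?d (?f ys) D B \<zeta>, B)])))))"
    by (subst bind_commute_pmf) simp
  also have "\<dots> = bind_pmf (?R t) (\<lambda>Bs. bind_pmf ?P (\<lambda>B. map_pmf (?zip (Bs @ [B])) (?comp (Bs @ [B]) (Suc t))))"
    by (intro bind_pmf_cong refl step[symmetric]) (auto simp: set_replicate_pmf)
  \<comment> \<open>\<open>replicate_pmf\<close> puts a new draw at the front, whereas traces grow
    at the end; splitting off a last draw by \<open>replicate_pmf_distrib\<close> reconciles the
    two.\<close>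
  also have "\<dots> = bind_pmf (?R (Suc t)) (\<lambda>Bs. map_pmf (?zip Bs) (?comp Bs (Suc t)))"
    using replicate_pmf_distrib[of t 1 ?P, unfolded replicate_pmf_1]
    by (simp add: bind_assoc_pmf bind_map_pmf bind_return_pmf del: composition.simps replicate_pmf.simps)
  finally show ?case .
qed (simp add: bind_return_pmf)

text \<open>Sets of indices form an uncountable type; bounding them by the number of samples makes
  the set of possible traces countable. The vector lengths are those for which
  \<open>valid_optimiser\<close> controls the parameters.\<close>

lemma dpvi_vpd_traces:
  "set_pmf (dpvi_vpd m opt scl q C \<sigma> \<omega> D t)
     \<subseteq> lists ({y. length y = gradient_dim m} \<times> Pow {..<length D})"
proof (induction t)
  case (Suc t)
  have B: "B \<in> Pow {..<length D}" if "B \<in> set_pmf (poisson_subsample (length D) q)" for B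
    using that set_poisson_subsample by blast
  show ?case
    by (auto simp: Let_def noisy_sum_def dest!: B subsetD[OF Suc] dest: subsetD; blast)
qed simp

section \<open>The view of a party\<close>

text \<open>The probability of an event after the bind is a countable sum over \<open>K\<close> of
  products, each measurable. Hence the second kernel needs to be measurable only for each fixed
  \<open>k\<close>.\<close>

lemma measurable_bind_pmf_countable:
  assumes g: "(\<lambda>\<omega>. measure_pmf (g \<omega>)) \<in> M \<rightarrow>\<^sub>M subprob_algebra (count_space UNIV)"
    and K: "countable K" "\<And>\<omega>. \<omega> \<in> space M \<Longrightarrow> set_pmf (g \<omega>) \<subseteq> K"
    and h: "\<And>k. k \<in> K \<Longrightarrow> (\<lambda>\<omega>. measure_pmf (h \<omega> k)) \<in> M \<rightarrow>\<^sub>M subprob_algebra (count_space UNIV)"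
  shows "(\<lambda>\<omega>. measure_pmf (bind_pmf (g \<omega>) (h \<omega>))) \<in> M \<rightarrow>\<^sub>M subprob_algebra (count_space UNIV)"
proof (rule measurable_subprob_algebra)
  fix A
  interpret K: sigma_finite_measure "count_space K"
    using K by (rule_tac sigma_finite_measure_count_space_countable)
  have meas: "(\<lambda>\<omega>. emeasure (measure_pmf (g \<omega>)) {k} * emeasure (measure_pmf (h \<omega> k)) A) \<in> borel_measurable M"
    if "k \<in> K" for k
    using measurable_compose[OF g measurable_emeasure_subprob_algebra]
      measurable_compose[OF h[OF that] measurable_emeasure_subprob_algebra] by simp
  have "emeasure (measure_pmf (bind_pmf (g \<omega>) (h \<omega>))) A =
      (\<integral>\<^sup>+k. emeasure (measure_pmf (g \<omega>)) {k} * emeasure (measure_pmf (h \<omega> k)) A \<partial>count_space K)"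
    if "\<omega> \<in> space M" for \<omega>
    using K(2)[OF that]
    by (auto simp: nn_integral_measure_pmf emeasure_pmf_single nn_integral_count_space_indicator
        indicator_def set_pmf_eq intro!: nn_integral_cong)
  \<comment> \<open>Once the pair is swapped so that the countable factor comes first, joint
    measurability reduces to measurability for each \<open>k\<close>.\<close>
  moreover have "(\<lambda>\<omega>. \<integral>\<^sup>+k. emeasure (measure_pmf (g \<omega>)) {k} * emeasure (measure_pmf (h \<omega> k)) A \<partial>count_space K)
      \<in> borel_measurable M"
    by (rule K.borel_measurable_nn_integral, subst measurable_pair_swap_iff)
      (auto intro!: measurable_pair_measure_countable1[OF K(1)] meas)
  ultimately show "(\<lambda>\<omega>. emeasure (measure_pmf (bind_pmf (g \<omega>) (h \<omega>))) A) \<in> borel_measurable M"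
    by (subst measurable_cong) auto
qed (auto simp: measure_pmf.subprob_space_axioms)

lemma measurable_dpvi_vpd:
  assumes m: "mixture_model m" and opt: "valid_optimiser m scl opt" and D: "D \<in> datasets m N"
  shows "(\<lambda>\<omega>. measure_pmf (dpvi_vpd m opt scl q C \<sigma> \<omega> D t))
      \<in> seed opt \<rightarrow>\<^sub>M subprob_algebra (count_space UNIV)"
proof (induction t)
  case 0
  then show ?case by (simp add: space_subprob_algebra measure_pmf.subprob_space_axioms)
next
  case (Suc t)
  let ?d = "gradient_dim m"
  let ?K = "lists ({y :: int list. length y = ?d} \<times> Pow {..<length D})"
  have "countable ?K"
    by (intro countable_lists countable_SIGMA countable_finite[of "Pow _"]) auto
  then show ?case
    unfolding dpvi_vpd.simps
  proof (rule measurable_bind_pmf_countable[OF Suc _ dpvi_vpd_traces])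
    fix trace assume K: "trace \<in> ?K"
    let ?ys = "map fst trace"
    have ys: "\<forall>y\<in>set ?ys. length y = ?d" using K by auto
    \<comment> \<open>For a fixed trace, the next iteration depends on \<omega> only through the
      clipped gradients of the samples. \<open>F\<close> collects them in a discrete random
      variable, and \<open>h\<close> treats this list as a dataset with the identity as per-example
      function.\<close>
    define F where "F = (\<lambda>\<omega>. map (\<lambda>g. g \<omega>)
      (map (\<lambda>x \<omega>. clipped_gradient m scl C (current_params m opt scl \<omega> ?ys) x) D))"
    define h where "h = (\<lambda>vs. bind_pmf (poisson_subsample (length D) q) (\<lambda>B.
      bind_pmf (replicate_pmf ?d (discrete_gaussian (C * \<sigma>))) (\<lambda>\<zeta>.
        return_pmf (trace @ [(noisy_sum ?d (\<lambda>_ v. v) vs B \<zeta>, B)]))))"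
    have F: "F \<in> seed opt \<rightarrow>\<^sub>M count_space UNIV"
      unfolding F_def
    proof (rule measurable_map_apply, clarsimp)
      fix x assume "x \<in> set D"
      then show "(\<lambda>\<omega>. clipped_gradient m scl C (current_params m opt scl \<omega> ?ys) x)
          \<in> seed opt \<rightarrow>\<^sub>M count_space UNIV"
        using m D opt ys
        by (intro measurable_clipped_gradient) (auto simp: datasets_def valid_optimiser_def)
    qed
    have "(let \<theta> = current_params m opt scl \<omega> ?ys in
          bind_pmf (poisson_subsample (length D) q) (\<lambda>B.
            bind_pmf (replicate_pmf ?d (discrete_gaussian (C * \<sigma>))) (\<lambda>\<zeta>.
              return_pmf (trace @ [(noisy_sum ?d (\<lambda>_. clipped_gradient m scl C \<theta>) D B \<zeta>, B)])))) = h (F \<omega>)" for \<omega>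
      unfolding h_def Let_def
    proof (intro bind_pmf_cong refl)
      fix B \<zeta> assume "B \<in> set_pmf (poisson_subsample (length D) q)"
      then have "B \<subseteq> {..<length D}" using set_poisson_subsample by blast
      then have "(\<Sum>i\<in>B. clipped_gradient m scl C (current_params m opt scl \<omega> ?ys) (D ! i) ! j)
          = (\<Sum>i\<in>B. F \<omega> ! i ! j)" for j
        by (intro sum.cong) (auto simp: F_def)
      then show "return_pmf (trace @ [(noisy_sum ?d (\<lambda>_. clipped_gradient m scl C (current_params m opt scl \<omega> ?ys)) D B \<zeta>, B)])
          = return_pmf (trace @ [(noisy_sum ?d (\<lambda>_ v. v) (F \<omega>) B \<zeta>, B)])"
        by (simp add: noisy_sum_def)
    qed
    then show "(\<lambda>\<omega>. measure_pmf (let \<theta> = current_params m opt scl \<omega> ?ys in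
          bind_pmf (poisson_subsample (length D) q) (\<lambda>B.
            bind_pmf (replicate_pmf ?d (discrete_gaussian (C * \<sigma>))) (\<lambda>\<zeta>.
              return_pmf (trace @ [(noisy_sum ?d (\<lambda>_. clipped_gradient m scl C \<theta>) D B \<zeta>, B)])))))
        \<in> seed opt \<rightarrow>\<^sub>M subprob_algebra (count_space UNIV)"
      using measurable_compose[OF F, of "\<lambda>vs. measure_pmf (h vs)" "subprob_algebra (count_space UNIV)"]
      by (simp add: space_subprob_algebra measure_pmf.subprob_space_axioms)
  qed
qed

theorem theorem5p3:
  fixes m :: "'a mixture" and opt :: "('r, 's) optimiser"
    and \<O> :: "real \<Rightarrow> real \<Rightarrow> nat \<Rightarrow> 'a list base_mechanism \<Rightarrow> ennreal"
    and \<delta> q C \<sigma> scl :: real and N T p :: nat and knows_indices :: "nat \<Rightarrow> bool"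
  assumes "mixture_model m"
    and "scl > 0" and "valid_optimiser m scl opt"
    and "0 \<le> q" and "q \<le> 1" and "C > 0" and "\<sigma> > 0"
    and "\<delta> \<ge> 0"
    and "accounting_oracle TYPE('r) C \<O>"
    and "p < parties m"
  shows "vpdp (parties m) (datasets m N)
           (\<O> \<delta> (if knows_indices p then 1 else q) T (discrete_gaussian_mechanism C \<sigma>)) \<delta>
           (party_view m opt scl q C \<sigma> T (knows_indices p))"
proof -
  let ?Q = "if knows_indices p then 1 else q" and ?A = "discrete_gaussian_mechanism C \<sigma> :: 'a list base_mechanism"
  let ?d = "gradient_dim m" and ?f = "gradient_step m opt scl C"
  let ?obs = "\<lambda>trace :: (int list \<times> nat set) list. if knows_indices p then Some (map snd trace) else None"
  let ?view = "\<lambda>D \<omega>. distr (measure_pmf (dpvi_vpd m opt scl q C \<sigma> \<omega> D T)) (seed opt \<Otimes>\<^sub>M count_space UNIV)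
         (\<lambda>trace. (\<omega>, map fst trace, ?obs trace))"
  have R: "prob_space (seed opt)" using assms by (simp add: valid_optimiser_def)
  have composition_private: "vpdp (parties m) (datasets m N) (\<O> \<delta> r T ?A) \<delta> (\<lambda>D. measure_pmf (composition ?A r ?d f D T))"
    if "0 \<le> r" "r \<le> 1" "\<And>ys i x. length (f ys i x) = ?d \<and> l2_norm (f ys i x) \<le> C" for r f
  proof (rule private_wrt_mono[OF accounting_oracleD[where N = N]])
    show "adjacent D D' \<or> D = D'"
      if "D \<in> datasets m N" "D' \<in> datasets m N" "vp_adjacent (parties m) D D'" for D D'
      using that by (rule vp_adjacent_imp_adjacent)
  qed (use assms that in \<open>auto simp: datasets_def\<close>)
  have f: "length (?f \<omega> ys i x) = ?d \<and> l2_norm (?f \<omega> ys i x) \<le> C" for \<omega> ys i x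
    using \<open>C > 0\<close> by (simp add: gradient_step_def length_clipped_gradient)
      (simp add: clipped_gradient_def l2_norm_clip)
  \<comment> \<open>Everything a party observes apart from \<omega>, with \<omega> held
    fixed.\<close>
  have trace: "vpdp (parties m) (datasets m N) (\<O> \<delta> ?Q T ?A) \<delta>
      (\<lambda>D. measure_pmf (map_pmf (\<lambda>trace. (map fst trace, ?obs trace)) (dpvi_vpd m opt scl q C \<sigma> \<omega> D T)))" for \<omega>
  proof (cases "knows_indices p")
    case True
    have "l2_norm (replicate n 0) = 0" for n
      by (simp add: l2_norm_def L2_set_def)
    with f \<open>C > 0\<close> have "length (restrict_steps ?d Bs (?f \<omega>) ys i x) = ?d
        \<and> l2_norm (restrict_steps ?d Bs (?f \<omega>) ys i x) \<le> C" for Bs ys i x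
      by (simp add: restrict_steps_def)
    \<comment> \<open>The sub-samples are drawn with \<open>N\<close> in place of
      \<open>length D\<close>, so that their law is visibly common to all datasets and can be
      integrated out by \<open>private_wrt_bind\<close>.\<close>
    then have "vpdp (parties m) (datasets m N) (\<O> \<delta> 1 T ?A) \<delta>
        (\<lambda>D. measure_pmf (bind_pmf (replicate_pmf T (poisson_subsample N q)) (\<lambda>Bs.
           map_pmf (\<lambda>ys. zip ys Bs) (composition ?A 1 ?d (restrict_steps ?d Bs (?f \<omega>)) D T))))"
      unfolding measure_pmf_bind
      by (intro private_wrt_bind[where M = "count_space UNIV"] private_wrt_map_pmf composition_private
          measure_pmf.prob_space_axioms)
        (auto simp: space_subprob_algebra measure_pmf.subprob_space_axioms)
    then have "vpdp (parties m) (datasets m N) (\<O> \<delta> 1 T ?A) \<delta>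
        (\<lambda>D. measure_pmf (dpvi_vpd m opt scl q C \<sigma> \<omega> D T))"
      by (rule private_wrt_cong) (auto simp: dpvi_vpd_eq_mixture datasets_def)
    with True show ?thesis by (simp only: if_True) (rule private_wrt_map_pmf)
  next
    case False
    \<comment> \<open>With the sub-samples hidden, the observation is a composition with ratio
      \<open>q\<close> paired with the constant \<open>None\<close>.\<close>
    have "vpdp (parties m) (datasets m N) (\<O> \<delta> q T ?A) \<delta>
        (\<lambda>D. measure_pmf (map_pmf (\<lambda>ys. (ys, None)) (composition ?A q ?d (?f \<omega>) D T)))"
      by (intro private_wrt_map_pmf composition_private f \<open>0 \<le> q\<close> \<open>q \<le> 1\<close>)
    with False show ?thesis by (simp add: map_pmf_comp flip: map_fst_dpvi_vpd)
  qed
  have "private_wrt (vp_adjacent (parties m)) (datasets m N) (\<O> \<delta> ?Q T ?A) \<delta> (\<lambda>D. seed opt \<bind> ?view D)"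
  proof (rule private_wrt_bind[OF R])
    fix D assume D: "D \<in> datasets m N"
    show "?view D \<in> seed opt \<rightarrow>\<^sub>M subprob_algebra (seed opt \<Otimes>\<^sub>M count_space UNIV)"
      by (rule measurable_distr2[OF _ measurable_dpvi_vpd[OF assms(1,3) D]], unfold case_prod_beta)
        (rule measurable_Pair[OF measurable_fst measurable_compose[OF measurable_snd]], simp)
  next
    fix \<omega> assume \<omega>: "\<omega> \<in> space (seed opt)"
    \<comment> \<open>For fixed \<omega>, disclosing \<omega> itself is post-processing by the map
      \<open>Pair \<omega>\<close>.\<close>
    have "?view D \<omega> = distr (measure_pmf (map_pmf (\<lambda>trace. (map fst trace, ?obs trace)) (dpvi_vpd m opt scl q C \<sigma> \<omega> D T)))
        (seed opt \<Otimes>\<^sub>M count_space UNIV) (Pair \<omega>)" for D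
      unfolding map_pmf_rep_eq using \<omega>
      by (subst distr_distr) (auto simp: space_pair_measure o_def)
    then show "vpdp (parties m) (datasets m N) (\<O> \<delta> ?Q T ?A) \<delta> (\<lambda>D. ?view D \<omega>)"
      using private_wrt_distr_pmf[OF trace, of "Pair \<omega>" "seed opt \<Otimes>\<^sub>M count_space UNIV"] \<omega>
      by (simp only: space_pair_measure) simp
  qed
  then show ?thesis unfolding party_view_def .
qed

end
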